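(* Let $\alpha>0$, $0<\beta\le 1$, $T>0$, $\lambda\in\mathbb{R}$ and $y_0^{(0)},\dots,y_0^{(\lceil\alpha\rceil-1)}\in\mathbb{R}$, where $\alpha=a_1/b_1$, $\beta=a_2/b_2$ with $(a_i,b_i)$ pairs of coprime integers, $a_i\ge 1$, $b_i\ge 2$. Put $\Lambda=[0,T]$, $D=\{(t,s)\in\Lambda\times\Lambda: 0\le s\le t\le T\}$, $\psi(t)=\sum_{k=0}^{\lceil\alpha\rceil-1}\frac{t^k}{k!}y_0^{(k)}$, $m_\psi=\min_{t\in\Lambda}\psi(t)$, $M_\psi=\max_{t\in\Lambda}\psi(t)$. Let $\zeta\ge 0$, $D_1=\Lambda\times[m_\psi-\zeta,M_\psi+\zeta]$ and $D_2=D\times[m_\psi-\zeta,M_\psi+\zeta]$, let $f:D_1\to\mathbb{R}$ and $g:D_2\to\mathbb{R}$ be continuous, and suppose that $$\zeta=\frac{\|f\|\,T^{\alpha}}{\Gamma(\alpha+1)}+\frac{\|g\|\,|\lambda|\,\Gamma(\beta)\,T^{\alpha+\beta}}{\Gamma(1+\alpha+\beta)},\qquad \|f\|=\max_{D_1}|f|,\quad \|g\|=\max_{D_2}|g| .$$ Let $\Omega_\zeta=\{y\in C(\Lambda): \max_{t\in\Lambda}|y(t)-\psi(t)|\le\zeta\}$, and assume that there are constants $L_1,L_2>0$ such that for all $z_1,z_2\in\Omega_\zeta$ and all $(t,s)\in D$, $$|f(t,z_1(t))-f(t,z_2(t))|\le L_1|z_1(t)-z_2(t)|,\qquad |g(t,s,z_1(s))-g(t,s,z_2(s))|\le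 L_2|z_1(s)-z_2(s)| .$$ Then the initial value problem $$D_C^{\alpha}y(t)=f(t,y(t))+\lambda\int_0^t(t-s)^{\beta-1}g(t,s,y(s))\,ds,\quad t\in\Lambda,\qquad y^{(k)}(0)=y_0^{(k)},\ k=0,\dots,\lceil\alpha\rceil-1,$$ has a unique continuous solution on $\Lambda$.
   Context: $I^{\alpha}$ is the Riemann–Liouville fractional integral, $I^{\alpha}h(t)=\frac{1}{\Gamma(\alpha)}\int_0^t(t-s)^{\alpha-1}h(s)\,ds$, and $D_C^{\alpha}=I^{\lceil\alpha\rceil-\alpha}\partial_t^{\lceil\alpha\rceil}$ is the Caputo derivative. A continuous solution of the initial value problem is understood as a continuous function $y$ on $\Lambda$ (with values in the interval $[m_\psi-\zeta,M_\psi+\zeta]$, so that the right-hand side makes sense) satisfying the equivalent weakly singular Volterra integral equation $$y(t)=\psi(t)+I^{\alpha}\big[f(\cdot,y(\cdot))\big](t)+\lambda\, I^{\alpha}\Big[\tau\mapsto\int_0^{\tau}(\tau-s)^{\beta-1}g(\tau,s,y(s))\,ds\Big](t),\quad t\in\Lambda .$$ *)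

theory Defs
  imports "HOL-Analysis.Analysis"
begin

(* The integrals below are Henstock-Kurzweil integrals; for the kernels (t - s) powr (a - 1),
   a > 0, against continuous functions they agree with the Lebesgue (improper Riemann) ones.
   At s = t the kernel takes the value 0 (0 powr a = 0), which does not affect the integral.
   Minima and maxima of continuous functions over compact sets are written with INF and SUP. *)

definition RL_integral :: "real \<Rightarrow> (real \<Rightarrow> real) \<Rightarrow> real \<Rightarrow> real" where
  "RL_integral \<alpha> h t = 1 / Gamma \<alpha> * integral {0..t} (\<lambda>s. (t - s) powr (\<alpha> - 1) * h s)"

definition psi :: "real \<Rightarrow> (nat \<Rightarrow> real) \<Rightarrow> real \<Rightarrow> real" where
  "psi \<alpha> y0 t = (\<Sum>k<nat \<lceil>\<alpha>\<rceil>. t ^ k / fact k * y0 k)"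

definition psi_min :: "real \<Rightarrow> (nat \<Rightarrow> real) \<Rightarrow> real \<Rightarrow> real" where
  "psi_min \<alpha> y0 T = (INF t\<in>{0..T}. psi \<alpha> y0 t)"

definition psi_max :: "real \<Rightarrow> (nat \<Rightarrow> real) \<Rightarrow> real \<Rightarrow> real" where
  "psi_max \<alpha> y0 T = (SUP t\<in>{0..T}. psi \<alpha> y0 t)"

definition value_range :: "real \<Rightarrow> (nat \<Rightarrow> real) \<Rightarrow> real \<Rightarrow> real \<Rightarrow> real set" where
  "value_range \<alpha> y0 T \<zeta> = {psi_min \<alpha> y0 T - \<zeta> .. psi_max \<alpha> y0 T + \<zeta>}"

definition time_triangle :: "real \<Rightarrow> (real \<times> real) set" where
  "time_triangle T = {(t, s). 0 \<le> s \<and> s \<le> t \<and> t \<le> T}"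

definition D1 :: "real \<Rightarrow> (nat \<Rightarrow> real) \<Rightarrow> real \<Rightarrow> real \<Rightarrow> (real \<times> real) set" where
  "D1 \<alpha> y0 T \<zeta> = {0..T} \<times> value_range \<alpha> y0 T \<zeta>"

definition D2 :: "real \<Rightarrow> (nat \<Rightarrow> real) \<Rightarrow> real \<Rightarrow> real \<Rightarrow> (real \<times> real \<times> real) set" where
  "D2 \<alpha> y0 T \<zeta> = {(t, s, x). (t, s) \<in> time_triangle T \<and> x \<in> value_range \<alpha> y0 T \<zeta>}"

definition sup_norm :: "'a set \<Rightarrow> ('a \<Rightarrow> real) \<Rightarrow> real" where
  "sup_norm S h = (SUP x\<in>S. \<bar>h x\<bar>)"

definition Omega :: "real \<Rightarrow> (nat \<Rightarrow> real) \<Rightarrow> real \<Rightarrow> real \<Rightarrow> (real \<Rightarrow> real) set" where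
  "Omega \<alpha> y0 T \<zeta> =
     {y. continuous_on {0..T} y \<and> sup_norm {0..T} (\<lambda>t. y t - psi \<alpha> y0 t) \<le> \<zeta>}"

(* A continuous solution of the initial value problem
     D_C^alpha y(t) = f(t, y(t)) + lam * int_0^t (t - s)^(beta - 1) g(t, s, y(s)) ds,
     y^(k)(0) = y0 k   for k < ceiling alpha,
   with D_C^alpha the Caputo derivative, is by convention a continuous function on {0..T}, with
   values where f and g are defined, that satisfies the equivalent Volterra integral equation.
   Values of y outside {0..T} are irrelevant. *)

definition continuous_solution ::
  "real \<Rightarrow> real \<Rightarrow> real \<Rightarrow> (nat \<Rightarrow> real) \<Rightarrow> real \<Rightarrow> real \<Rightarrow>
   (real \<times> real \<Rightarrow> real) \<Rightarrow> (real \<times> real \<times> real \<Rightarrow> real) \<Rightarrow> (real \<Rightarrow> real) \<Rightarrow> bool" where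
  "continuous_solution \<alpha> \<beta> lam y0 T \<zeta> f g y \<longleftrightarrow>
     continuous_on {0..T} y \<and>
     (\<forall>t\<in>{0..T}. y t \<in> value_range \<alpha> y0 T \<zeta>) \<and>
     (\<forall>t\<in>{0..T}.
        y t = psi \<alpha> y0 t + RL_integral \<alpha> (\<lambda>s. f (s, y s)) t
            + lam * RL_integral \<alpha>
                (\<lambda>\<tau>. integral {0..\<tau>} (\<lambda>s. (\<tau> - s) powr (\<beta> - 1) * g (\<tau>, s, y s))) t)"

end

theory Submission
  imports Defs
begin

text \<open>
  The right-hand side of the Volterra equation is an operator on the functions within distance
  \<open>\<zeta>\<close> of \<open>\<psi>\<close>: the value of \<open>\<zeta>\<close> is exactly the bound that \<open>I\<^sup>\<alpha> 1\<close> and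
  \<open>I\<^sup>\<alpha> \<tau>\<^sup>\<beta>\<close> give, and it also shows that every solution with values in the admissible
  interval lies in that ball. Since \<open>I\<^sup>a\<close> multiplies the weight \<open>exp (N t)\<close> by at most
  \<open>N\<^sup>-\<^sup>a\<close>, the operator is a contraction in the weighted norm \<open>sup exp (- N t) \<bar>y t\<bar>\<close> for large
  \<open>N\<close>, on the whole interval at once, and Banach's theorem applies.
\<close>

section \<open>The singular kernel and its integrability\<close>

lemma Gamma_real_neq_0: "a > 0 \<Longrightarrow> Gamma a \<noteq> (0::real)"
  using Gamma_real_pos[of a] by linarith

lemma Gamma_real_plus1: "a > 0 \<Longrightarrow> Gamma (a + 1) = a * Gamma (a::real)"
  by (rule Gamma_plus1) (auto dest: nonpos_Ints_nonpos)

lemma has_integral_kernel_rescale: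
  fixes h :: "real \<Rightarrow> real"
  assumes "t \<ge> 0"
    and "((\<lambda>u. (1 - u) powr (a - 1) * h (t * u)) has_integral I) {0..1}"
  shows "((\<lambda>s. (t - s) powr (a - 1) * h s) has_integral t powr a * I) {0..t}"
proof (cases "t = 0")
  case True
  then show ?thesis using has_integral_refl(2)[of _ "0::real"] by simp
next
  case False
  with assms have t: "t > 0" by simp
  have "((\<lambda>s. (1 - s / t) powr (a - 1) * h s) has_integral t * I) {0..t}"
    using has_integral_affinity'[of "\<lambda>u. (1 - u) powr (a - 1) * h (t * u)" I 0 "1::real" "1 / t" 0]
      assms(2) t
    by (simp add: mult.commute)
  then have "((\<lambda>s. t powr (a - 1) * ((1 - s / t) powr (a - 1) * h s)) has_integral
      t powr (a - 1) * (t * I)) {0..t}"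
    by (rule has_integral_mult_right)
  moreover have "t powr (a - 1) * (t * I) = t powr a * I"
    using t by (simp add: powr_diff)
  moreover have "t powr (a - 1) * ((1 - s / t) powr (a - 1) * h s) = (t - s) powr (a - 1) * h s"
    if "s \<in> {0..t}" for s
  proof -
    have "t - s = t * (1 - s / t)" using t by (simp add: field_simps)
    then show ?thesis using t that by (simp add: powr_mult)
  qed
  ultimately show ?thesis by (metis (no_types, lifting) has_integral_eq)
qed

lemma has_integral_kernel_unit:
  fixes a :: real
  assumes "a > 0"
  shows "((\<lambda>u. (1 - u) powr (a - 1)) has_integral 1 / a) {0..1}"
proof -
  have "((\<lambda>u. u powr (1 - 1) * (1 - u) powr (a - 1)) has_integral Beta 1 a) {0..1::real}"
    using assms by (intro has_integral_Beta_real) auto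
  moreover have "Beta 1 a = 1 / a"
    using assms by (simp add: Beta_def add.commute[of 1] Gamma_real_plus1 Gamma_real_neq_0)
  ultimately have "((\<lambda>u. u powr (1 - 1) * (1 - u) powr (a - 1)) has_integral 1 / a) {0..1::real}"
    by simp
  \<comment> \<open>The integrands differ only at \<open>u = 0\<close>, where
    \<open>0 powr 0\<close> is 0 by convention.\<close>
  then show ?thesis
    by (rule has_integral_spike_finite[of "{0}", rotated 2]) auto
qed

text \<open>Henstock-Kurzweil integrability alone need not survive multiplication by a continuous
  function; absolute integrability does. The kernel has it because it is nonnegative, and
  \<open>h\<close> is bounded and measurable on the compact interval.\<close>

lemma kernel_absolutely_integrable:
  fixes a :: real and h :: "real \<Rightarrow> real"
  assumes "a > 0" and h: "continuous_on {0..1} h"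
  shows "(\<lambda>u. (1 - u) powr (a - 1) * h u) absolutely_integrable_on {0..1}"
proof -
  have "(\<lambda>u. (1 - u) powr (a - 1)) absolutely_integrable_on {0..1}"
    using has_integral_kernel_unit[OF assms(1)]
    by (intro nonnegative_absolutely_integrable_1) (auto simp: integrable_on_def)
  moreover have "bounded (h ` {0..1})"
    using h by (intro compact_imp_bounded compact_continuous_image) auto
  ultimately have "(\<lambda>u. h u * (1 - u) powr (a - 1)) absolutely_integrable_on {0..1}"
    using h by (intro absolutely_integrable_bounded_measurable_product_real
      continuous_imp_measurable_on_sets_lebesgue) auto
  then show ?thesis by (simp add: mult.commute)
qed

text \<open>The first form carries the integrability that linearity and comparison rely on. The
  second has a fixed interval and a fixed kernel, which is what continuity in \<open>t\<close>
  relies on.\<close>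

lemma RL_kernel_integral:
  fixes h :: "real \<Rightarrow> real"
  assumes "a > 0" "t \<ge> 0" and h: "continuous_on {0..t} h"
  shows "((\<lambda>s. (t - s) powr (a - 1) * h s) has_integral Gamma a * RL_integral a h t) {0..t}"
    and "Gamma a * RL_integral a h t =
      t powr a * integral {0..1} (\<lambda>u. (1 - u) powr (a - 1) * h (t * u))"
proof -
  have "continuous_on {0..1} (\<lambda>u. h (t * u))"
    using \<open>t \<ge> 0\<close> by (intro continuous_on_compose2[OF h] continuous_intros)
      (auto intro: mult_left_le)
  from kernel_absolutely_integrable[OF \<open>a > 0\<close> this]
  have "((\<lambda>u. (1 - u) powr (a - 1) * h (t * u)) has_integral
      integral {0..1} (\<lambda>u. (1 - u) powr (a - 1) * h (t * u))) {0..1}"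
    by (intro integrable_integral set_lebesgue_integral_eq_integral(1))
  from has_integral_kernel_rescale[OF \<open>t \<ge> 0\<close> this]
  have I: "((\<lambda>s. (t - s) powr (a - 1) * h s) has_integral
      t powr a * integral {0..1} (\<lambda>u. (1 - u) powr (a - 1) * h (t * u))) {0..t}" .
  show E: "Gamma a * RL_integral a h t =
      t powr a * integral {0..1} (\<lambda>u. (1 - u) powr (a - 1) * h (t * u))"
    using integral_unique[OF I] Gamma_real_neq_0[OF \<open>a > 0\<close>] by (simp add: RL_integral_def)
  show "((\<lambda>s. (t - s) powr (a - 1) * h s) has_integral Gamma a * RL_integral a h t) {0..t}"
    using I unfolding E .
qed

lemma RL_integral_unique:
  assumes "((\<lambda>s. (t - s) powr (a - 1) * h s) has_integral I) {0..t}"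
  shows "RL_integral a h t = I / Gamma a"
  using integral_unique[OF assms] by (simp add: RL_integral_def)

section \<open>Fractional integrals of constants, powers and exponentials\<close>

lemma RL_integral_const:
  assumes "a > 0" "t \<ge> 0"
  shows "RL_integral a (\<lambda>_. c) t = c * t powr a / Gamma (a + 1)"
proof -
  have "((\<lambda>s. (t - s) powr (a - 1) * c) has_integral t powr a * (1 / a * c)) {0..t}"
    by (intro has_integral_kernel_rescale has_integral_mult_left has_integral_kernel_unit assms)
  from RL_integral_unique[OF this] show ?thesis
    using \<open>a > 0\<close> by (simp add: Gamma_real_plus1 mult.commute)
qed

text \<open>Homogeneity takes \<open>t powr b\<close> out of the rescaled integral and leaves
  \<open>Beta (b + 1) a\<close>, whose factor \<open>Gamma a\<close> cancels the
  normalisation.\<close>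

lemma RL_integral_powr:
  assumes "a > 0" "b > 0" "t \<ge> 0"
  shows "RL_integral a (\<lambda>s. c * s powr b) t = c * Gamma (b + 1) * t powr (a + b) / Gamma (a + b + 1)"
proof -
  have "((\<lambda>u. c * t powr b * (u powr (b + 1 - 1) * (1 - u) powr (a - 1))) has_integral
      c * t powr b * Beta (b + 1) a) {0..1}"
    using assms by (intro has_integral_mult_right has_integral_Beta_real) auto
  then have "((\<lambda>u. (1 - u) powr (a - 1) * (c * (t * u) powr b)) has_integral
      c * t powr b * Beta (b + 1) a) {0..1}"
    by (rule has_integral_eq[rotated]) (use \<open>t \<ge> 0\<close> in \<open>auto simp: powr_mult\<close>)
  from has_integral_kernel_rescale[where h = "\<lambda>s. c * s powr b", OF \<open>t \<ge> 0\<close> this]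
  have "RL_integral a (\<lambda>s. c * s powr b) t = t powr a * (c * t powr b * Beta (b + 1) a) / Gamma a"
    by (rule RL_integral_unique)
  also have "\<dots> = c * Gamma (b + 1) * t powr (a + b) / Gamma (a + b + 1)"
    using \<open>a > 0\<close> by (simp add: Gamma_real_neq_0 Beta_def powr_add add_ac)
  finally show ?thesis .
qed

text \<open>With \<open>v = N * (t - s)\<close> the left side becomes
  \<open>exp (N * t) * N powr - a / Gamma a\<close> times the Gamma integral truncated to
  \<open>{0..N * t}\<close>. Its integrand is nonnegative, so the truncated integral is at most
  \<open>Gamma a\<close>.\<close>

lemma RL_integral_exp_le:
  assumes "a > 0" "N > 0" "t \<ge> 0"
  shows "RL_integral a (\<lambda>s. exp (N * s)) t \<le> exp (N * t) * N powr - a"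
proof -
  define w where "w = (\<lambda>v::real. v powr (a - 1) / exp v)"
  have G: "(w has_integral Gamma a) {0..}"
    unfolding w_def by (rule Gamma_integral_real) fact
  then obtain I where I: "(w has_integral I) {0..N * t}"
    using integrable_on_subinterval[of w "{0..}" 0 "N * t"] by (auto simp: integrable_on_def)
  have "I \<le> Gamma a"
    by (rule has_integral_subset_le[OF _ I G]) (auto simp: w_def)
  \<comment> \<open>The affine map carries \<open>{0..t}\<close> onto \<open>{0..N * t}\<close> with
    reversed orientation; only the modulus \<open>N\<close> of its slope enters the value.\<close>
  have "((\<lambda>s. w (- N * s + N * t)) has_integral I / N) {0..t}"
    using has_integral_affinity[of w I 0 "N * t" "- N" "N * t"] I \<open>N > 0\<close> \<open>t \<ge> 0\<close>
      image_affinity_atLeastAtMost[of "- (1 / N)" t 0 "N * t"] by simp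
  then have "((\<lambda>s. N powr (1 - a) * exp (N * t) * w (- N * s + N * t)) has_integral
      N powr (1 - a) * exp (N * t) * (I / N)) {0..t}"
    by (rule has_integral_mult_right)
  then have "((\<lambda>s. (t - s) powr (a - 1) * exp (N * s)) has_integral
      N powr (1 - a) * exp (N * t) * (I / N)) {0..t}"
  proof (rule has_integral_eq[rotated])
    fix s assume s: "s \<in> {0..t}"
    have "w (- N * s + N * t) = w (N * (t - s))" by (simp add: algebra_simps)
    also have "\<dots> = N powr (a - 1) * (t - s) powr (a - 1) * exp (N * s) / exp (N * t)"
      using s \<open>N > 0\<close> powr_mult[of N "t - s" "a - 1"]
      by (simp add: w_def right_diff_distrib exp_diff)
    finally show "N powr (1 - a) * exp (N * t) * w (- N * s + N * t) =
        (t - s) powr (a - 1) * exp (N * s)"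
      using \<open>N > 0\<close> by (simp add: powr_diff field_simps)
  qed
  from RL_integral_unique[OF this]
  have "RL_integral a (\<lambda>s. exp (N * s)) t = exp (N * t) * N powr - a * (I / Gamma a)"
    using \<open>N > 0\<close> by (simp add: powr_diff powr_minus field_simps)
  also have "\<dots> \<le> exp (N * t) * N powr - a * 1"
    using \<open>I \<le> Gamma a\<close> Gamma_real_pos[OF \<open>a > 0\<close>] by (intro mult_left_mono) auto
  finally show ?thesis by simp
qed

section \<open>Linearity and comparison\<close>

text \<open>Valid for every \<open>h\<close>: for nonzero \<open>c\<close> both integrands are
  integrable or neither is, and a non-integrable function has \<open>integral\<close> 0. So
  constants can be moved out before anything is known about a candidate solution.\<close>

lemma RL_integral_cmult: "RL_integral a (\<lambda>s. c * h s) t = c * RL_integral a h t"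
  unfolding RL_integral_def by (simp add: mult.left_commute)

lemma RL_integral_diff:
  assumes "a > 0" "t \<ge> 0" "continuous_on {0..t} h" "continuous_on {0..t} k"
  shows "RL_integral a (\<lambda>s. h s - k s) t = RL_integral a h t - RL_integral a k t"
proof -
  have "((\<lambda>s. (t - s) powr (a - 1) * h s - (t - s) powr (a - 1) * k s) has_integral
      Gamma a * RL_integral a h t - Gamma a * RL_integral a k t) {0..t}"
    by (intro has_integral_diff RL_kernel_integral assms)
  then have "((\<lambda>s. (t - s) powr (a - 1) * (h s - k s)) has_integral
      Gamma a * (RL_integral a h t - RL_integral a k t)) {0..t}"
    by (simp add: right_diff_distrib)
  from RL_integral_unique[OF this] show ?thesis
    using Gamma_real_pos[OF \<open>a > 0\<close>] by simp
qed

text \<open>The kernel is nonnegative and \<open>Gamma a\<close> positive, so a pointwise majorant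
  passes through the integral. The operator is estimated with a constant, a power or an exponential
  as \<open>k\<close>.\<close>

lemma RL_integral_abs_le:
  assumes "a > 0" "t \<ge> 0" "continuous_on {0..t} h" "continuous_on {0..t} k"
    and le: "\<And>s. s \<in> {0..t} \<Longrightarrow> \<bar>h s\<bar> \<le> k s"
  shows "\<bar>RL_integral a h t\<bar> \<le> RL_integral a k t"
proof -
  note I = RL_kernel_integral(1)[OF assms(1,2)]
  have "norm (integral {0..t} (\<lambda>s. (t - s) powr (a - 1) * h s)) \<le>
      integral {0..t} (\<lambda>s. (t - s) powr (a - 1) * k s)"
    using I[OF assms(3)] I[OF assms(4)] le
    by (intro integral_norm_bound_integral)
      (auto simp: integrable_on_def abs_mult intro!: mult_left_mono)
  then show ?thesis
    using Gamma_real_pos[OF \<open>a > 0\<close>] by (simp add: RL_integral_def abs_mult divide_right_mono)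
qed

section \<open>Continuity of fractional integrals in time\<close>

text \<open>Uniform continuity on the compact rectangle makes \<open>F (r, u)\<close> close to
  \<open>F (t, u)\<close> for all \<open>u\<close> at once; the kernel, being independent of time,
  turns this into closeness of the integrals.\<close>

lemma continuous_on_parametric_kernel:
  fixes F :: "real \<times> real \<Rightarrow> real"
  assumes "a > 0" and F: "continuous_on ({0..T} \<times> {0..1}) F"
  shows "continuous_on {0..T} (\<lambda>t. integral {0..1} (\<lambda>u. (1 - u) powr (a - 1) * F (t, u)))"
  unfolding continuous_on_iff
proof (intro ballI allI impI)
  fix t e :: real assume t: "t \<in> {0..T}" and e: "e > 0"
  have int: "(\<lambda>u. (1 - u) powr (a - 1) * F (r, u)) integrable_on {0..1}" if "r \<in> {0..T}" for r
  proof -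
    have "continuous_on {0..1} (\<lambda>u. F (r, u))"
      using that by (intro continuous_on_compose2[OF F] continuous_intros) auto
    from kernel_absolutely_integrable[OF \<open>a > 0\<close> this] show ?thesis
      by (rule set_lebesgue_integral_eq_integral(1))
  qed
  have "uniformly_continuous_on ({0..T} \<times> {0..1}) F"
    using F by (intro compact_uniformly_continuous compact_Times) auto
  \<comment> \<open>The kernel has total mass \<open>1 / a\<close>, so this tolerance gives
    \<open>e / 2\<close> after integration; the half restores the strictness lost in comparing
    integrals.\<close>
  moreover have "e * a / 2 > 0" using e \<open>a > 0\<close> by simp
  ultimately obtain d where d: "d > 0" and F_close: "\<And>x y. x \<in> {0..T} \<times> {0..1} \<Longrightarrow>
      y \<in> {0..T} \<times> {0..1} \<Longrightarrow> dist y x < d \<Longrightarrow> dist (F y) (F x) < e * a / 2"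
    unfolding uniformly_continuous_on_def by metis
  let ?I = "\<lambda>t. integral {0..1} (\<lambda>u. (1 - u) powr (a - 1) * F (t, u))"
  have "dist (?I r) (?I t) < e" if r: "r \<in> {0..T}" "dist r t < d" for r
  proof -
    have "norm (integral {0..1} (\<lambda>u. (1 - u) powr (a - 1) * F (r, u) - (1 - u) powr (a - 1) * F (t, u)))
        \<le> integral {0..1} (\<lambda>u. (1 - u) powr (a - 1) * (e * a / 2))"
    proof (rule integral_norm_bound_integral)
      fix u :: real assume u: "u \<in> {0..1}"
      have "dist (F (r, u)) (F (t, u)) < e * a / 2"
        using r t u by (intro F_close) (auto simp: dist_Pair_Pair)
      then have "\<bar>F (r, u) - F (t, u)\<bar> \<le> e * a / 2" by (simp add: dist_real_def)
      then show "norm ((1 - u) powr (a - 1) * F (r, u) - (1 - u) powr (a - 1) * F (t, u))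
          \<le> (1 - u) powr (a - 1) * (e * a / 2)"
        by (simp add: abs_mult mult_left_mono del: times_divide_eq_right flip: right_diff_distrib)
    qed (use int r t has_integral_kernel_unit[OF \<open>a > 0\<close>] in
        \<open>auto intro!: integrable_diff integrable_on_mult_left intro: has_integral_integrable\<close>)
    also have "\<dots> = e / 2"
      using \<open>a > 0\<close>
      by (subst integral_unique[OF has_integral_mult_left[OF has_integral_kernel_unit]]) auto
    also have "\<dots> < e" using e by simp
    finally show ?thesis
      using int r t by (simp add: dist_real_def Henstock_Kurzweil_Integration.integral_diff)
  qed
  with d show "\<exists>d>0. \<forall>r\<in>{0..T}. dist r t < d \<longrightarrow> dist (?I r) (?I t) < e" by blast
qed

text \<open>The substitution \<open>s = t u\<close> makes the singular factor independent of \<open>t\<close>.\<close>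

lemma continuous_on_RL_integral:
  fixes k :: "real \<times> real \<Rightarrow> real"
  assumes "a > 0" and k: "continuous_on (time_triangle T) k"
  shows "continuous_on {0..T} (\<lambda>t. RL_integral a (\<lambda>s. k (t, s)) t)"
proof -
  have "continuous_on ({0..T} \<times> {0..1}) (\<lambda>(t, u). k (t, t * u))"
    unfolding case_prod_unfold
    by (intro continuous_on_compose2[OF k] continuous_intros)
      (auto simp: time_triangle_def intro: mult_left_le)
  \<comment> \<open>The factor \<open>t powr a\<close> is continuous up to \<open>t = 0\<close>
    because \<open>a > 0\<close>.\<close>
  from continuous_on_parametric_kernel[OF \<open>a > 0\<close> this]
  have "continuous_on {0..T} (\<lambda>t. t powr a *
      integral {0..1} (\<lambda>u. (1 - u) powr (a - 1) * k (t, t * u)) / Gamma a)"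
    using \<open>a > 0\<close> by (intro continuous_intros continuous_on_powr') (auto simp: Gamma_real_neq_0)
  moreover have "t powr a * integral {0..1} (\<lambda>u. (1 - u) powr (a - 1) * k (t, t * u)) / Gamma a =
      RL_integral a (\<lambda>s. k (t, s)) t" if "t \<in> {0..T}" for t
  proof -
    have "continuous_on {0..t} (\<lambda>s. k (t, s))"
      using that by (intro continuous_on_compose2[OF k] continuous_intros)
        (auto simp: time_triangle_def)
    from RL_kernel_integral(2)[OF \<open>a > 0\<close> _ this] that Gamma_real_pos[OF \<open>a > 0\<close>]
    show ?thesis by (simp add: field_simps)
  qed
  ultimately show ?thesis by (metis (no_types, lifting) continuous_on_cong)
qed

section \<open>Banach's theorem in a weighted norm\<close>

text \<open>The premise \<open>contr\<close> is the Lipschitz estimate for the weighted norm, stated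
  with an arbitrary bound \<open>M\<close> so that no supremum has to be formed. Functions on
  \<open>{0..T}\<close> are transported to bounded continuous functions on the line, a complete
  space, and uniqueness comes back as equality on \<open>{0..T}\<close>.\<close>

lemma weighted_contraction_fixpoint:
  fixes A :: "(real \<Rightarrow> real) \<Rightarrow> real \<Rightarrow> real" and p :: "real \<Rightarrow> real" and T \<zeta> q N :: real
  assumes \<Omega>_def: "\<Omega> = {y. continuous_on {0..T} y \<and> (\<forall>t\<in>{0..T}. \<bar>y t - p t\<bar> \<le> \<zeta>)}"
    and "T \<ge> 0" "\<zeta> \<ge> 0" "0 \<le> q" "q < 1"
    and p: "continuous_on {0..T} p"
    and maps: "\<And>y. y \<in> \<Omega> \<Longrightarrow> A y \<in> \<Omega>"
    and contr: "\<And>y z M t. y \<in> \<Omega> \<Longrightarrow> z \<in> \<Omega> \<Longrightarrow> M \<ge> 0 \<Longrightarrow>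
      (\<And>s. s \<in> {0..T} \<Longrightarrow> \<bar>y s - z s\<bar> \<le> M * exp (N * s)) \<Longrightarrow> t \<in> {0..T} \<Longrightarrow>
      \<bar>A y t - A z t\<bar> \<le> q * (M * exp (N * t))"
  shows "\<exists>y\<in>\<Omega>. (\<forall>t\<in>{0..T}. A y t = y t) \<and>
    (\<forall>z\<in>\<Omega>. (\<forall>t\<in>{0..T}. A z t = z t) \<longrightarrow> (\<forall>t\<in>{0..T}. z t = y t))"
proof -
  \<comment> \<open>Clamping to \<open>{0..T}\<close> extends a continuous function on the interval
    to a bounded continuous one on the line.\<close>
  define c where "c = (\<lambda>t. max 0 (min T t))"
  have c_in: "c t \<in> {0..T}" for t using \<open>T \<ge> 0\<close> by (auto simp: c_def)
  have c_id: "t \<in> {0..T} \<Longrightarrow> c t = t" for t by (auto simp: c_def)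
  \<comment> \<open>The weight is built into the embedding, so the ordinary sup distance of images
    is the weighted distance of the functions. \<open>dec\<close> removes the weight and inverts
    \<open>emb\<close> on \<open>{0..T}\<close>.\<close>
  define emb :: "(real \<Rightarrow> real) \<Rightarrow> real \<Rightarrow>\<^sub>C real"
    where "emb = (\<lambda>y. Bcontfun (\<lambda>t. exp (- (N * c t)) * y (c t)))"
  define dec where "dec = (\<lambda>(u :: real \<Rightarrow>\<^sub>C real) t. exp (N * t) * u t)"
  have emb_apply: "emb y t = exp (- (N * c t)) * y (c t)" if y: "continuous_on {0..T} y" for y t
  proof -
    have "bounded ((\<lambda>t. exp (- (N * t)) * y t) ` {0..T})"
      using y by (intro compact_imp_bounded compact_continuous_image continuous_intros) auto
    then have "bounded (range (\<lambda>t. exp (- (N * c t)) * y (c t)))"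
      by (rule bounded_subset) (use c_in in auto)
    moreover have "continuous_on UNIV (\<lambda>t. y (c t))"
      by (intro continuous_on_compose2[OF y]) (use c_in in \<open>auto simp: c_def intro!: continuous_intros\<close>)
    then have "continuous_on UNIV (\<lambda>t. exp (- (N * c t)) * y (c t))"
      unfolding c_def by (intro continuous_intros)
    ultimately show ?thesis
      unfolding emb_def by (subst Bcontfun_inverse) (auto simp: bcontfun_def)
  qed
  have dec_emb: "dec (emb y) t = y t" if "continuous_on {0..T} y" "t \<in> {0..T}" for y t
    using that by (simp add: dec_def emb_apply c_id flip: exp_add mult.assoc)
  \<comment> \<open>The tube around \<open>p\<close> after multiplication by the weight. Being cut
    out by closed balls it is closed, hence complete.\<close>
  define S where "S = PiC {0..T} (\<lambda>t. cball (exp (- (N * t)) * p t) (exp (- (N * t)) * \<zeta>))"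
  have S_iff: "u \<in> S \<longleftrightarrow> dec u \<in> \<Omega>" for u
  proof -
    have "dist (exp (- (N * t)) * p t) (u t) \<le> exp (- (N * t)) * \<zeta> \<longleftrightarrow> \<bar>dec u t - p t\<bar> \<le> \<zeta>" for t
    proof -
      have "exp (- (N * t)) * p t - u t = exp (- (N * t)) * (p t - dec u t)"
        by (simp add: dec_def right_diff_distrib flip: exp_add mult.assoc)
      then show ?thesis
        by (simp add: dist_real_def abs_mult abs_minus_commute)
    qed
    moreover have "continuous_on {0..T} (dec u)"
      unfolding dec_def by (intro continuous_intros continuous_on_apply_bcontfun)
    ultimately show ?thesis by (auto simp: S_def \<Omega>_def mem_PiC_iff Pi_iff)
  qed
  \<comment> \<open>The case \<open>M = 0\<close> of \<open>contr\<close>: on \<open>{0..T}\<close>,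
    \<open>A y\<close> depends only on the values of \<open>y\<close> there. This matters because
    \<open>dec (emb z)\<close> need not equal \<open>z\<close> elsewhere.\<close>
  have cong: "A y t = A z t"
    if "y \<in> \<Omega>" "z \<in> \<Omega>" "\<And>s. s \<in> {0..T} \<Longrightarrow> y s = z s" "t \<in> {0..T}" for y z t
    using contr[of y z 0 t] that by simp
  have \<Omega>_cont: "y \<in> \<Omega> \<Longrightarrow> continuous_on {0..T} y" for y by (simp add: \<Omega>_def)
  have emb_S: "emb y \<in> S" if "y \<in> \<Omega>" for y
  proof -
    have "continuous_on {0..T} (dec (emb y))"
      unfolding dec_def by (intro continuous_intros continuous_on_apply_bcontfun)
    then show ?thesis using that by (simp add: S_iff) (simp add: \<Omega>_def dec_emb)
  qed
  define \<Phi> where "\<Phi> = (\<lambda>u. emb (A (dec u)))"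
  have "\<exists>!u\<in>S. \<Phi> u = u"
  proof (rule Banach_fix[OF _ _ \<open>0 \<le> q\<close> \<open>q < 1\<close>])
    show "complete S"
      unfolding S_def complete_eq_closed by (intro closed_PiC) auto
    have "p \<in> \<Omega>" using p \<open>\<zeta> \<ge> 0\<close> by (simp add: \<Omega>_def)
    then show "S \<noteq> {}" using emb_S by blast
    show "\<Phi> ` S \<subseteq> S" using emb_S maps S_iff by (auto simp: \<Phi>_def)
    fix u v assume uv: "u \<in> S" "v \<in> S"
    then have uv\<Omega>: "dec u \<in> \<Omega>" "dec v \<in> \<Omega>" by (auto simp: S_iff)
    show "dist (\<Phi> u) (\<Phi> v) \<le> q * dist u v"
    proof (rule dist_bound)
      fix t
      \<comment> \<open>Removing the weight multiplies by \<open>exp (N * s)\<close>, so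
        \<open>M = dist u v\<close> is admissible in \<open>contr\<close>; the weight at
        \<open>c t\<close> cancels again afterwards.\<close>
      have "\<bar>dec u s - dec v s\<bar> \<le> dist u v * exp (N * s)" for s
        using dist_bounded[of u s v]
        by (simp add: dec_def dist_real_def abs_mult flip: right_diff_distrib)
      from contr[OF uv\<Omega> _ this c_in]
      have "\<bar>A (dec u) (c t) - A (dec v) (c t)\<bar> \<le> q * (dist u v * exp (N * c t))" by simp
      then show "dist (\<Phi> u t) (\<Phi> v t) \<le> q * dist u v"
        using maps uv\<Omega> \<Omega>_cont
        by (simp add: \<Phi>_def emb_apply dist_real_def abs_mult exp_minus field_simps
            flip: right_diff_distrib)
    qed
  qed
  then obtain u where u: "u \<in> S" "\<Phi> u = u" and u_unique: "\<And>v. v \<in> S \<Longrightarrow> \<Phi> v = v \<Longrightarrow> v = u"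
    by blast
  show ?thesis
  proof (intro bexI[of _ "dec u"] conjI ballI impI)
    show "dec u \<in> \<Omega>" using u S_iff by blast
    then show "A (dec u) t = dec u t" if "t \<in> {0..T}" for t
      using dec_emb[of "A (dec u)" t] that u(2) maps \<Omega>_cont by (simp add: \<Phi>_def)
  next
    fix z t assume z: "z \<in> \<Omega>" "\<forall>t\<in>{0..T}. A z t = z t" and t: "t \<in> {0..T}"
    have "A (dec (emb z)) s = z s" if "s \<in> {0..T}" for s
      using cong[of "dec (emb z)" z s] that z emb_S[of z] S_iff \<Omega>_cont dec_emb by simp
    \<comment> \<open>Equality on the interval suffices, since clamping determines an embedded
      function everywhere else.\<close>
    then have "\<Phi> (emb z) = emb z"
      using z emb_S[of z] S_iff \<Omega>_cont maps c_in
      by (intro bcontfun_eqI) (simp add: \<Phi>_def emb_apply)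
    then have "emb z = u" using u_unique emb_S z(1) by blast
    then show "z t = dec u t" using dec_emb[of z t] z(1) \<Omega>_cont t by simp
  qed
qed

section \<open>Norms, domains and the contraction rate\<close>

text \<open>A real \<open>SUP\<close> is a least upper bound only for nonempty bounded sets;
  boundedness comes from compactness and continuity.\<close>

lemma sup_norm_le_iff:
  assumes "compact S" "S \<noteq> {}" "continuous_on S h"
  shows "sup_norm S h \<le> c \<longleftrightarrow> (\<forall>x\<in>S. \<bar>h x\<bar> \<le> c)"
proof -
  have "bdd_above ((\<lambda>x. \<bar>h x\<bar>) ` S)"
    using assms by (intro bounded_imp_bdd_above compact_imp_bounded compact_continuous_image
      continuous_intros)
  then show ?thesis using assms(2) by (simp add: sup_norm_def cSUP_le_iff)
qed

lemma continuous_on_psi: "continuous_on S (psi \<alpha> y0)"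
  unfolding psi_def by (intro continuous_intros) auto

text \<open>The tube around \<psi> lies in the strip where \<open>f\<close> and \<open>g\<close> are
  given: \<psi> is bounded on the interval, so its \<open>INF\<close> and \<open>SUP\<close> really
  bound it.\<close>

lemma value_range_memI:
  assumes "t \<in> {0..T}" "\<bar>x - psi \<alpha> y0 t\<bar> \<le> \<zeta>"
  shows "x \<in> value_range \<alpha> y0 T \<zeta>"
proof -
  have "bounded (psi \<alpha> y0 ` {0..T})"
    by (intro compact_imp_bounded compact_continuous_image continuous_on_psi) auto
  then have "psi_min \<alpha> y0 T \<le> psi \<alpha> y0 t" "psi \<alpha> y0 t \<le> psi_max \<alpha> y0 T"
    unfolding psi_min_def psi_max_def using assms(1)
    by (auto intro!: cINF_lower cSUP_upper bounded_imp_bdd_below bounded_imp_bdd_above)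
  with assms(2) show ?thesis by (auto simp: value_range_def)
qed

lemma compact_D1: "compact (D1 \<alpha> y0 T \<zeta>)"
  unfolding D1_def value_range_def by (intro compact_Times compact_Icc)

lemma compact_D2: "compact (D2 \<alpha> y0 T \<zeta>)"
proof -
  have "D2 \<alpha> y0 T \<zeta> = ({0..T} \<times> {0..T} \<times> value_range \<alpha> y0 T \<zeta>) \<inter> {x. fst (snd x) \<le> fst x}"
    by (auto simp: D2_def time_triangle_def)
  then show ?thesis
    by (auto simp: value_range_def intro!: compact_Int_closed compact_Times closed_Collect_le
        continuous_intros)
qed

lemma D1_memI: "t \<in> {0..T} \<Longrightarrow> x \<in> value_range \<alpha> y0 T \<zeta> \<Longrightarrow> (t, x) \<in> D1 \<alpha> y0 T \<zeta>"
  by (simp add: D1_def)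

lemma D2_memI:
  "(t, s) \<in> time_triangle T \<Longrightarrow> x \<in> value_range \<alpha> y0 T \<zeta> \<Longrightarrow> (t, s, x) \<in> D2 \<alpha> y0 T \<zeta>"
  by (simp add: D2_def)

lemma continuous_on_triangle_section:
  assumes "continuous_on (time_triangle T) (\<lambda>(t, s). h t s)" "t \<in> {0..T}"
  shows "continuous_on {0..t} (h t)"
proof -
  have "continuous_on {0..t} (Pair t)" by (intro continuous_intros)
  moreover have "Pair t ` {0..t} \<subseteq> time_triangle T"
    using assms(2) by (auto simp: time_triangle_def)
  ultimately show ?thesis using continuous_on_compose2[OF assms(1), of "{0..t}" "Pair t"] by simp
qed

text \<open>With \<open>c = L1\<close> and \<open>d = \<bar>lam\<bar> * Gamma \<beta> * L2\<close>
  this is the contraction factor for the weight with exponent \<open>N\<close>. Each negative power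
  of \<open>N\<close> tends to 0, and the factor with it.\<close>

lemma exists_contraction_rate:
  fixes c d :: real
  assumes "\<alpha> > 0" "\<beta> > 0"
  shows "\<exists>N>0. c * N powr - \<alpha> + d * (N powr - \<beta> * N powr - \<alpha>) < 1"
proof -
  have lim: "((\<lambda>N::real. N powr - a) \<longlongrightarrow> 0) at_top" if "a > 0" for a :: real
    using that by (intro tendsto_neg_powr filterlim_ident) auto
  have "((\<lambda>N. c * N powr - \<alpha> + d * (N powr - \<beta> * N powr - \<alpha>)) \<longlongrightarrow> c * 0 + d * (0 * 0)) at_top"
    by (intro tendsto_intros lim assms)
  then have "\<forall>\<^sub>F N in at_top. c * N powr - \<alpha> + d * (N powr - \<beta> * N powr - \<alpha>) < 1"
    by (rule order_tendstoD) simp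
  then have "\<forall>\<^sub>F N in at_top. N > 0 \<and> c * N powr - \<alpha> + d * (N powr - \<beta> * N powr - \<alpha>) < 1"
    using eventually_gt_at_top[of 0] by (rule eventually_elim2) simp
  then show ?thesis by (auto dest: eventually_happens)
qed

section \<open>Existence and uniqueness for the Volterra equation\<close>

theorem theorem1:
  fixes \<alpha> \<beta> T lam \<zeta> L1 L2 :: real
    and y0 :: "nat \<Rightarrow> real"
    and a1 b1 a2 b2 :: int
    and f :: "real \<times> real \<Rightarrow> real"
    and g :: "real \<times> real \<times> real \<Rightarrow> real"
  assumes "\<alpha> > 0" and "0 < \<beta>" and "\<beta> \<le> 1" and "T > 0"
    and "\<alpha> = real_of_int a1 / real_of_int b1" and "\<beta> = real_of_int a2 / real_of_int b2"
    and "coprime a1 b1" and "coprime a2 b2"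
    and "a1 \<ge> 1" and "a2 \<ge> 1" and "b1 \<ge> 2" and "b2 \<ge> 2"
    and "\<zeta> \<ge> 0"
    and "continuous_on (D1 \<alpha> y0 T \<zeta>) f"
    and "continuous_on (D2 \<alpha> y0 T \<zeta>) g"
    and "\<zeta> = sup_norm (D1 \<alpha> y0 T \<zeta>) f * T powr \<alpha> / Gamma (\<alpha> + 1)
           + sup_norm (D2 \<alpha> y0 T \<zeta>) g * \<bar>lam\<bar> * Gamma \<beta> * T powr (\<alpha> + \<beta>)
               / Gamma (1 + \<alpha> + \<beta>)"
    and "L1 > 0" and "L2 > 0"
    and "\<And>z1 z2 t s. z1 \<in> Omega \<alpha> y0 T \<zeta> \<Longrightarrow> z2 \<in> Omega \<alpha> y0 T \<zeta> \<Longrightarrow> (t, s) \<in> time_triangle T \<Longrightarrow>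
           \<bar>f (t, z1 t) - f (t, z2 t)\<bar> \<le> L1 * \<bar>z1 t - z2 t\<bar>"
    and "\<And>z1 z2 t s. z1 \<in> Omega \<alpha> y0 T \<zeta> \<Longrightarrow> z2 \<in> Omega \<alpha> y0 T \<zeta> \<Longrightarrow> (t, s) \<in> time_triangle T \<Longrightarrow>
           \<bar>g (t, s, z1 s) - g (t, s, z2 s)\<bar> \<le> L2 * \<bar>z1 s - z2 s\<bar>"
  shows "\<exists>y. continuous_solution \<alpha> \<beta> lam y0 T \<zeta> f g y \<and>
           (\<forall>z. continuous_solution \<alpha> \<beta> lam y0 T \<zeta> f g z \<longrightarrow> (\<forall>t\<in>{0..T}. z t = y t))"
proof -
  note f = assms(14) and g = assms(15) and lip_f = assms(19) and lip_g = assms(20)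
  let ?p = "psi \<alpha> y0" and ?R = "value_range \<alpha> y0 T \<zeta>"
  let ?\<Omega> = "{y. continuous_on {0..T} y \<and> (\<forall>t\<in>{0..T}. \<bar>y t - ?p t\<bar> \<le> \<zeta>)}"
  define F where "F = (\<lambda>y s. f (s, y s))"
  \<comment> \<open>The inner integral divided by \<open>Gamma \<beta>\<close>: as a fractional
    integral it falls under the same estimates as the outer one. The factor reappears in
    \<open>A\<close>.\<close>
  define G where "G = (\<lambda>y \<tau>. RL_integral \<beta> (\<lambda>s. g (\<tau>, s, y s)) \<tau>)"
  define A where "A = (\<lambda>y t. ?p t + RL_integral \<alpha> (F y) t
    + lam * (Gamma \<beta> * RL_integral \<alpha> (G y) t))"
  define Mf where "Mf = sup_norm (D1 \<alpha> y0 T \<zeta>) f"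
  define Mg where "Mg = sup_norm (D2 \<alpha> y0 T \<zeta>) g"
  have \<Gamma>: "Gamma \<beta> > 0" using \<open>0 < \<beta>\<close> by simp
  \<comment> \<open>The admissible range is nonempty, so \<open>D1\<close> and \<open>D2\<close>
    contain points from which \<open>Mf \<ge> 0\<close> and \<open>Mg \<ge> 0\<close> can be read
    off.\<close>
  have p_R: "?p 0 \<in> ?R" using \<open>\<zeta> \<ge> 0\<close> \<open>T > 0\<close> by (intro value_range_memI[of 0]) auto
  have Mf: "\<bar>f x\<bar> \<le> Mf" if "x \<in> D1 \<alpha> y0 T \<zeta>" for x
    using sup_norm_le_iff[OF compact_D1 _ f, of Mf] that by (auto simp: Mf_def)
  have Mg: "\<bar>g x\<bar> \<le> Mg" if "x \<in> D2 \<alpha> y0 T \<zeta>" for x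
    using sup_norm_le_iff[OF compact_D2 _ g, of Mg] that by (auto simp: Mg_def)
  have "Mf \<ge> 0"
    using Mf[OF D1_memI[OF _ p_R], of 0] \<open>T > 0\<close> by simp
  have "Mg \<ge> 0"
    using Mg[OF D2_memI[OF _ p_R], of 0 0] \<open>T > 0\<close> by (simp add: time_triangle_def)
  have Omega: "Omega \<alpha> y0 T \<zeta> = ?\<Omega>"
    using \<open>T > 0\<close> by (auto simp: Omega_def sup_norm_le_iff continuous_on_diff continuous_on_psi)

  \<comment> \<open>Values in the admissible range are asked of \<open>y\<close>, not membership in
    the tube, so that \<open>A_\<Omega>\<close> also applies to an arbitrary solution.\<close>
  have gy: "continuous_on (time_triangle T) (\<lambda>(t, s). g (t, s, y s))"
    and F_cont: "continuous_on {0..T} (F y)"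
    and G_cont: "continuous_on {0..T} (G y)"
    and A_\<Omega>: "A y \<in> ?\<Omega>"
    if y: "continuous_on {0..T} y" and y_R: "\<forall>t\<in>{0..T}. y t \<in> ?R" for y
  proof -
    show F_cont: "continuous_on {0..T} (F y)"
      unfolding F_def using y_R
      by (intro continuous_on_compose2[OF f] continuous_intros y) (auto simp: D1_def)
    have "continuous_on (time_triangle T) (\<lambda>x. y (snd x))"
      by (intro continuous_on_compose2[OF y] continuous_intros) (auto simp: time_triangle_def)
    then show gy: "continuous_on (time_triangle T) (\<lambda>(t, s). g (t, s, y s))"
      unfolding case_prod_unfold using y_R
      by (intro continuous_on_compose2[OF g] continuous_intros)
        (auto simp: D2_def time_triangle_def)
    show G_cont: "continuous_on {0..T} (G y)"
      using continuous_on_RL_integral[OF \<open>0 < \<beta>\<close> gy] by (simp add: G_def)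
    have RL_cont: "continuous_on {0..T} (RL_integral \<alpha> h)" if h: "continuous_on {0..T} h" for h
    proof -
      have "continuous_on (time_triangle T) (\<lambda>x. h (snd x))"
        by (intro continuous_on_compose2[OF h] continuous_intros) (auto simp: time_triangle_def)
      from continuous_on_RL_integral[OF \<open>\<alpha> > 0\<close> this] show ?thesis by simp
    qed
    have "continuous_on {0..T} (A y)"
      unfolding A_def by (intro continuous_intros continuous_on_psi RL_cont F_cont G_cont)
    moreover have "\<bar>A y t - ?p t\<bar> \<le> \<zeta>" if t: "t \<in> {0..T}" for t
    proof -
      have sub: "{0..t} \<subseteq> {0..T}" using t by auto
      have "\<bar>RL_integral \<alpha> (F y) t\<bar> \<le> RL_integral \<alpha> (\<lambda>_. Mf) t"
        using t y_R by (intro RL_integral_abs_le \<open>\<alpha> > 0\<close> continuous_intros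
          continuous_on_subset[OF F_cont sub]) (auto simp: F_def intro!: Mf D1_memI)
      also have "\<dots> = Mf * t powr \<alpha> / Gamma (\<alpha> + 1)"
        using t \<open>\<alpha> > 0\<close> by (intro RL_integral_const) auto
      also have "\<dots> \<le> Mf * T powr \<alpha> / Gamma (\<alpha> + 1)"
        using t \<open>\<alpha> > 0\<close> \<open>Mf \<ge> 0\<close> by (intro divide_right_mono mult_left_mono powr_mono2) auto
      finally have 1: "\<bar>RL_integral \<alpha> (F y) t\<bar> \<le> Mf * T powr \<alpha> / Gamma (\<alpha> + 1)" .
      \<comment> \<open>Keeping \<open>\<tau> powr \<beta>\<close> instead of
        \<open>T powr \<beta>\<close> lets the outer integral give exactly the second term of
        \<zeta>.\<close>
      have "\<bar>G y \<tau>\<bar> \<le> Mg / Gamma (\<beta> + 1) * \<tau> powr \<beta>" if \<tau>: "\<tau> \<in> {0..T}" for \<tau>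
      proof -
        have "\<bar>G y \<tau>\<bar> \<le> RL_integral \<beta> (\<lambda>_. Mg) \<tau>"
          unfolding G_def using \<tau> y_R
          by (intro RL_integral_abs_le \<open>0 < \<beta>\<close> continuous_intros
              continuous_on_triangle_section[OF gy])
            (auto intro!: Mg D2_memI simp: time_triangle_def)
        also have "\<dots> = Mg / Gamma (\<beta> + 1) * \<tau> powr \<beta>"
          using \<tau> \<open>0 < \<beta>\<close> by (simp add: RL_integral_const)
        finally show ?thesis .
      qed
      then have "\<bar>RL_integral \<alpha> (G y) t\<bar> \<le> RL_integral \<alpha> (\<lambda>\<tau>. Mg / Gamma (\<beta> + 1) * \<tau> powr \<beta>) t"
        using t \<open>0 < \<beta>\<close> by (intro RL_integral_abs_le \<open>\<alpha> > 0\<close> continuous_intros continuous_on_powr'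
          continuous_on_subset[OF G_cont sub]) auto
      also have "\<dots> = Mg / Gamma (\<beta> + 1) * Gamma (\<beta> + 1) * t powr (\<alpha> + \<beta>) / Gamma (\<alpha> + \<beta> + 1)"
        using t \<open>0 < \<beta>\<close> \<open>\<alpha> > 0\<close> by (intro RL_integral_powr) auto
      also have "\<dots> = Mg * t powr (\<alpha> + \<beta>) / Gamma (1 + \<alpha> + \<beta>)"
        using \<open>0 < \<beta>\<close> by (simp add: Gamma_real_neq_0 add_ac)
      also have "\<dots> \<le> Mg * T powr (\<alpha> + \<beta>) / Gamma (1 + \<alpha> + \<beta>)"
        using t \<open>\<alpha> > 0\<close> \<open>0 < \<beta>\<close> \<open>Mg \<ge> 0\<close>
        by (intro divide_right_mono mult_left_mono powr_mono2) auto
      finally have 2: "\<bar>lam\<bar> * (Gamma \<beta> * \<bar>RL_integral \<alpha> (G y) t\<bar>) \<le>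
          \<bar>lam\<bar> * (Gamma \<beta> * (Mg * T powr (\<alpha> + \<beta>) / Gamma (1 + \<alpha> + \<beta>)))"
        using \<Gamma> by (intro mult_left_mono) auto
      have "\<bar>A y t - ?p t\<bar> \<le> \<bar>RL_integral \<alpha> (F y) t\<bar> + \<bar>lam\<bar> * (Gamma \<beta> * \<bar>RL_integral \<alpha> (G y) t\<bar>)"
        using abs_triangle_ineq[of "RL_integral \<alpha> (F y) t" "lam * (Gamma \<beta> * RL_integral \<alpha> (G y) t)"] \<Gamma>
        by (simp add: A_def abs_mult)
      also have "\<dots> \<le> \<zeta>"
        using 1 2 assms(16)[folded Mf_def Mg_def] by (simp add: mult_ac)
      finally show ?thesis .
    qed
    ultimately show "A y \<in> ?\<Omega>" by simp
  qed
  have \<Omega>_R: "y t \<in> ?R" if "y \<in> ?\<Omega>" "t \<in> {0..T}" for y t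
    using that by (intro value_range_memI) auto

  obtain N where "N > 0"
    and q_less: "L1 * N powr - \<alpha> + \<bar>lam\<bar> * Gamma \<beta> * L2 * (N powr - \<beta> * N powr - \<alpha>) < 1"
    using exists_contraction_rate[OF \<open>\<alpha> > 0\<close> \<open>0 < \<beta>\<close>] by blast
  define q where "q = L1 * N powr - \<alpha> + \<bar>lam\<bar> * Gamma \<beta> * L2 * (N powr - \<beta> * N powr - \<alpha>)"
  have "q \<ge> 0" "q < 1"
    using q_less \<Gamma> \<open>L1 > 0\<close> \<open>L2 > 0\<close> by (auto simp: q_def)
  have contr: "\<bar>A y t - A z t\<bar> \<le> q * (M * exp (N * t))"
    if yz: "y \<in> ?\<Omega>" "z \<in> ?\<Omega>" and "M \<ge> 0"
      and le: "\<And>s. s \<in> {0..T} \<Longrightarrow> \<bar>y s - z s\<bar> \<le> M * exp (N * s)" and t: "t \<in> {0..T}"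
    for y z M t
  proof -
    have sub: "{0..t} \<subseteq> {0..T}" using t by auto
    have y: "continuous_on {0..T} y" and z: "continuous_on {0..T} z" using yz by auto
    have yR: "\<forall>t\<in>{0..T}. y t \<in> ?R" and zR: "\<forall>t\<in>{0..T}. z t \<in> ?R"
      using \<Omega>_R yz by blast+
    note FG_cont = F_cont[OF y yR] F_cont[OF z zR] G_cont[OF y yR] G_cont[OF z zR]
    note FG_cont_t = FG_cont[THEN continuous_on_subset, OF sub]
    have exp_bound: "RL_integral a (\<lambda>s. C * exp (N * s)) r \<le> C * N powr - a * exp (N * r)"
      if "a > 0" "C \<ge> 0" "r \<ge> 0" for a C r
      using mult_left_mono[OF RL_integral_exp_le[OF \<open>a > 0\<close> \<open>N > 0\<close> \<open>r \<ge> 0\<close>] \<open>C \<ge> 0\<close>]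
      by (simp add: RL_integral_cmult mult_ac)
    have "\<bar>RL_integral \<alpha> (\<lambda>s. F y s - F z s) t\<bar> \<le> RL_integral \<alpha> (\<lambda>s. L1 * M * exp (N * s)) t"
    proof (intro RL_integral_abs_le \<open>\<alpha> > 0\<close> continuous_intros FG_cont_t)
      fix s assume "s \<in> {0..t}"
      then have s: "s \<in> {0..T}" using sub by blast
      \<comment> \<open>The Lipschitz hypothesis on \<open>f\<close> is quantified over the
        triangle, so it is used at the diagonal point \<open>(s, s)\<close>.\<close>
      then have "\<bar>F y s - F z s\<bar> \<le> L1 * \<bar>y s - z s\<bar>"
        unfolding F_def using yz Omega by (intro lip_f[of _ _ s s]) (auto simp: time_triangle_def)
      also have "\<dots> \<le> L1 * (M * exp (N * s))"
        using le[OF s] \<open>L1 > 0\<close> by (intro mult_left_mono) auto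
      finally show "\<bar>F y s - F z s\<bar> \<le> L1 * M * exp (N * s)" by (simp add: mult.assoc)
    qed (use t in auto)
    also have "\<dots> \<le> L1 * M * N powr - \<alpha> * exp (N * t)"
      using t \<open>L1 > 0\<close> \<open>M \<ge> 0\<close> \<open>\<alpha> > 0\<close> by (intro exp_bound) auto
    finally have 1: "\<bar>RL_integral \<alpha> (\<lambda>s. F y s - F z s) t\<bar> \<le> L1 * M * N powr - \<alpha> * exp (N * t)" .
    \<comment> \<open>The inner integration gains \<open>N powr - \<beta>\<close> and reproduces the
      weight, so the outer one can gain \<open>N powr - \<alpha>\<close> on top; hence the product
      in \<open>q\<close>.\<close>
    have "\<bar>G y \<tau> - G z \<tau>\<bar> \<le> L2 * M * N powr - \<beta> * exp (N * \<tau>)" if \<tau>: "\<tau> \<in> {0..T}" for \<tau>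
    proof -
      have g\<tau>: "continuous_on {0..\<tau>} (\<lambda>s. g (\<tau>, s, y s))" "continuous_on {0..\<tau>} (\<lambda>s. g (\<tau>, s, z s))"
        by (intro continuous_on_triangle_section[OF _ \<tau>] gy y z yR zR)+
      have "\<bar>G y \<tau> - G z \<tau>\<bar> = \<bar>RL_integral \<beta> (\<lambda>s. g (\<tau>, s, y s) - g (\<tau>, s, z s)) \<tau>\<bar>"
        unfolding G_def using \<tau> \<open>0 < \<beta>\<close> g\<tau> by (subst RL_integral_diff) auto
      also have "\<dots> \<le> RL_integral \<beta> (\<lambda>s. L2 * M * exp (N * s)) \<tau>"
      proof (intro RL_integral_abs_le \<open>0 < \<beta>\<close> continuous_intros g\<tau>)
        fix s assume s: "s \<in> {0..\<tau>}"
        then have "\<bar>g (\<tau>, s, y s) - g (\<tau>, s, z s)\<bar> \<le> L2 * \<bar>y s - z s\<bar>"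
          using yz Omega \<tau> by (intro lip_g) (auto simp: time_triangle_def)
        also have "\<dots> \<le> L2 * (M * exp (N * s))"
          using le[of s] s \<tau> \<open>L2 > 0\<close> by (intro mult_left_mono) auto
        finally show "\<bar>g (\<tau>, s, y s) - g (\<tau>, s, z s)\<bar> \<le> L2 * M * exp (N * s)"
          by (simp add: mult.assoc)
      qed (use \<tau> in auto)
      also have "\<dots> \<le> L2 * M * N powr - \<beta> * exp (N * \<tau>)"
        using \<tau> \<open>L2 > 0\<close> \<open>M \<ge> 0\<close> \<open>0 < \<beta>\<close> by (intro exp_bound) auto
      finally show ?thesis .
    qed
    then have "\<bar>RL_integral \<alpha> (\<lambda>\<tau>. G y \<tau> - G z \<tau>) t\<bar> \<le>
        RL_integral \<alpha> (\<lambda>\<tau>. L2 * M * N powr - \<beta> * exp (N * \<tau>)) t"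
      using t by (intro RL_integral_abs_le \<open>\<alpha> > 0\<close> continuous_intros FG_cont_t) auto
    also have "\<dots> \<le> L2 * M * N powr - \<beta> * N powr - \<alpha> * exp (N * t)"
      using t \<open>L2 > 0\<close> \<open>M \<ge> 0\<close> \<open>\<alpha> > 0\<close> by (intro exp_bound) auto
    finally have 2: "\<bar>lam\<bar> * (Gamma \<beta> * \<bar>RL_integral \<alpha> (\<lambda>\<tau>. G y \<tau> - G z \<tau>) t\<bar>) \<le>
        \<bar>lam\<bar> * (Gamma \<beta> * (L2 * M * N powr - \<beta> * N powr - \<alpha> * exp (N * t)))"
      using \<Gamma> by (intro mult_left_mono) auto
    have "A y t - A z t = RL_integral \<alpha> (\<lambda>s. F y s - F z s) t
        + lam * (Gamma \<beta> * RL_integral \<alpha> (\<lambda>\<tau>. G y \<tau> - G z \<tau>) t)"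
      using t \<open>\<alpha> > 0\<close> FG_cont_t by (simp add: A_def RL_integral_diff algebra_simps)
    then have "\<bar>A y t - A z t\<bar> \<le> \<bar>RL_integral \<alpha> (\<lambda>s. F y s - F z s) t\<bar>
        + \<bar>lam\<bar> * (Gamma \<beta> * \<bar>RL_integral \<alpha> (\<lambda>\<tau>. G y \<tau> - G z \<tau>) t\<bar>)"
      using abs_triangle_ineq[of "RL_integral \<alpha> (\<lambda>s. F y s - F z s) t"
          "lam * (Gamma \<beta> * RL_integral \<alpha> (\<lambda>\<tau>. G y \<tau> - G z \<tau>) t)"] \<Gamma>
      by (simp add: abs_mult)
    also have "\<dots> \<le> L1 * M * N powr - \<alpha> * exp (N * t)
        + \<bar>lam\<bar> * (Gamma \<beta> * (L2 * M * N powr - \<beta> * N powr - \<alpha> * exp (N * t)))"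
      using 1 2 by (rule add_mono)
    also have "\<dots> = q * (M * exp (N * t))"
      by (simp only: q_def distrib_left distrib_right mult_ac)
    finally show ?thesis .
  qed

  have "\<exists>y\<in>?\<Omega>. (\<forall>t\<in>{0..T}. A y t = y t) \<and>
      (\<forall>z\<in>?\<Omega>. (\<forall>t\<in>{0..T}. A z t = z t) \<longrightarrow> (\<forall>t\<in>{0..T}. z t = y t))"
  proof (rule weighted_contraction_fixpoint[OF refl, where q = q and N = N])
    show "A y \<in> ?\<Omega>" if "y \<in> ?\<Omega>" for y
      using that \<Omega>_R[OF that] by (intro A_\<Omega>) auto
    show "\<bar>A y t - A z t\<bar> \<le> q * (M * exp (N * t))"
      if "y \<in> ?\<Omega>" "z \<in> ?\<Omega>" "M \<ge> 0" "\<And>s. s \<in> {0..T} \<Longrightarrow> \<bar>y s - z s\<bar> \<le> M * exp (N * s)"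
        "t \<in> {0..T}" for y z M t
      using that by (rule contr)
  qed (use \<open>T > 0\<close> \<open>\<zeta> \<ge> 0\<close> \<open>q \<ge> 0\<close> \<open>q < 1\<close> continuous_on_psi in auto)
  then obtain y where y: "y \<in> ?\<Omega>" "\<forall>t\<in>{0..T}. A y t = y t"
    and y_unique: "\<And>z. z \<in> ?\<Omega> \<Longrightarrow> \<forall>t\<in>{0..T}. A z t = z t \<Longrightarrow> \<forall>t\<in>{0..T}. z t = y t"
    by blast
  have solution_iff: "continuous_solution \<alpha> \<beta> lam y0 T \<zeta> f g y \<longleftrightarrow>
      y \<in> ?\<Omega> \<and> (\<forall>t\<in>{0..T}. A y t = y t)" for y
  proof -
    have inner: "(\<lambda>\<tau>. integral {0..\<tau>} (\<lambda>s. (\<tau> - s) powr (\<beta> - 1) * g (\<tau>, s, y s))) =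
        (\<lambda>\<tau>. Gamma \<beta> * G y \<tau>)"
      using \<Gamma> by (simp add: G_def RL_integral_def)
    have "continuous_solution \<alpha> \<beta> lam y0 T \<zeta> f g y \<longleftrightarrow>
        continuous_on {0..T} y \<and> (\<forall>t\<in>{0..T}. y t \<in> ?R) \<and> (\<forall>t\<in>{0..T}. A y t = y t)"
      unfolding continuous_solution_def inner RL_integral_cmult
      by (auto simp: A_def F_def)
    \<comment> \<open>A solution agrees with \<open>A y\<close> on the interval and so inherits its
      distance from \<psi>. Uniqueness inside the tube is thereby uniqueness among all
      solutions.\<close>
    moreover have "y \<in> ?\<Omega>"
      if "continuous_on {0..T} y" "\<forall>t\<in>{0..T}. y t \<in> ?R" "\<forall>t\<in>{0..T}. A y t = y t"
      using A_\<Omega>[of y] that by auto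
    ultimately show ?thesis using \<Omega>_R by blast
  qed
  show ?thesis
  proof (intro exI[of _ y] conjI allI impI)
    show "continuous_solution \<alpha> \<beta> lam y0 T \<zeta> f g y"
      using y solution_iff by blast
    show "\<forall>t\<in>{0..T}. z t = y t" if "continuous_solution \<alpha> \<beta> lam y0 T \<zeta> f g z" for z
      using that unfolding solution_iff by (intro y_unique) simp_all
  qed
qed

end
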